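(* Let $p,q$ be primes. There exist tiles $S$ of $T_p$ and $S'$ of $T_q$ with $\#L(S)=\#L(S')$. Moreover, let $S$ be any tile of $T_p$ and $S'$ any tile of $T_q$ with $\#L(S)=\#L(S')$, and let $f\colon L(S)\to L(S')$ be any bijection. For $n\ge 1$ let $L_n(S)=\{\ell_1\cdots\ell_n : \ell_1,\dots,\ell_n\in L(S)\}\subseteq\Sigma_p^*$, and define $L_n(S')\subseteq\Sigma_q^*$ likewise. Then for every $n\ge1$: (i) $\{\mathbb{B}_\lambda:\lambda\in L_n(S)\}$ is a partition of $\mathbb{Z}_p$ and $\{\mathbb{B}_{\lambda'}:\lambda'\in L_n(S')\}$ is a partition of $\mathbb{Z}_q$; (ii) $f_n(\ell_1\ell_2\cdots\ell_n)=f(\ell_1)f(\ell_2)\cdots f(\ell_n)$ gives a well-defined bijection $f_n\colon L_n(S)\to L_n(S')$, and hence $g_n(\mathbb{B}_\lambda)=\mathbb{B}_{f_n(\lambda)}$ defines a bijection between these two partitions; (iii) for all $\lambda\in L_n(S)$ and $\kappa\in L_{n+1}(S)$, $\mathbb{B}_\kappa\subseteq\mathbb{B}_\lambda$ if and only if $g_{n+1}(\mathbb{B}_\kappa)\subseteq g_n(\mathbb{B}_\lambda)$. Furthermore, the bijections $g_n$ define a homeomorphism $\phi\colon\mathbb{Z}_p\to\mathbb{Z}_q$: for $x\in\mathbb{Z}_p$, if $\lambda_n(x)$ denotes the unique element of $L_n(S)$ with $x\in\mathbb{B}_{\lambda_n(x)}$, then $\bigcap_{n\ge1}g_n(\mathbb{B}_{\lambda_n(x)})$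 is a single point $\phi(x)$, and $\phi$ is a homeomorphism.
   Context: For a prime $p$, $\Sigma_p=\{0,1,\dots,p-1\}$ and $\Sigma_p^*$ is the monoid of finite words over $\Sigma_p$ under concatenation, with identity the empty word $\epsilon$; $|w|$ is the length of $w$. The full infinite $p$-ary rooted tree $T_p$ has vertex set $V(T_p)=\Sigma_p^*$, root $\epsilon$, and edges $(w,wc)$ for $w\in\Sigma_p^*$, $c\in\Sigma_p$; the children of $w$ are the words $wc$. A subtree $S$ of $T_p$ is a connected subgraph, with vertex set $V(S)$ and edge set $E(S)$; it is nontrivial if $E(S)\ne\varnothing$. $L(S)$ denotes the set of leaves of $S$, i.e. nodes of $S$ having no children in $S$. $\Sigma_p^*$ acts on $T_p$ by left translation: $\omega\cdot v=\omega v$ on vertices and $\omega(v,v')=(\omega v,\omega v')$ on edges; $\omega S$ is the translate of $S$. A tiling of $T_p$ is a pair $(S,\Omega)$ where $S$ is a nontrivial finite subtree of $T_p$ and $\Omega\subseteq\Sigma_p^*$ is a subset such that: every vertex of $T_p$ is of the form $\omega s$ with $\omega\in\Omega$, $s\in V(S)$; every edge of $T_p$ is of the form $\omega e$ with $\omega\in\Omega$, $e\in E(S)$; and for distinct $\omega,\omega'\in\Omega$ the subgraphs $\omega S$ and $\omega' S$ have no common edge. A tile of $T_p$ is a subtree $S$ occurring in some tiling $(S,\Omega)$ of $T_p$. For $w=a_0a_1\cdots a_{n-1}\in\Sigma_p^*$ put $N(w)=a_0+a_1p+\cdots+a_{n-1}p^{n-1}$ and let $\mathbb{B}_w=\{x\in\mathbb{Z}_p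 : |x-N(w)|_p<p^{-|w|+1}\}$ be the associated $p$-adic ball, with $\mathbb{B}_\epsilon=\mathbb{Z}_p$; similarly for $q$. Spaces $\mathbb{Z}_p,\mathbb{Z}_q$ carry their standard $p$-adic and $q$-adic metric topologies. A partition is a subdivision into pairwise disjoint nonempty subsets. *)

theory Defs
  imports
    "Graph_Theory.Pair_Digraph"
    "Graph_Theory.Digraph_Component"
    "HOL-Analysis.Analysis"
    "HOL-Computational_Algebra.Primes"
begin

section \<open>The $p$-adic integers\<close>

text \<open>
  A $p$-adic integer is a coherent sequence of residues: \<open>x n\<close> is the representative in
  \<open>{0..<p^n}\<close> of the class of \<open>x\<close> modulo \<open>p^n\<close>.
\<close>

definition padic_ints :: "nat \<Rightarrow> (nat \<Rightarrow> int) set" where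
  "padic_ints p = {x. \<forall>n. x n \<in> {0..<int p ^ n} \<and> x (Suc n) mod int p ^ n = x n}"

definition padic_of_int :: "nat \<Rightarrow> int \<Rightarrow> (nat \<Rightarrow> int)" where
  "padic_of_int p k = (\<lambda>n. k mod int p ^ n)"

definition padic_diff :: "nat \<Rightarrow> (nat \<Rightarrow> int) \<Rightarrow> (nat \<Rightarrow> int) \<Rightarrow> (nat \<Rightarrow> int)" where
  "padic_diff p x y = (\<lambda>n. (x n - y n) mod int p ^ n)"

text \<open>\<open>x n = 0\<close> says that \<open>p^n\<close> divides \<open>x\<close>; it always holds for \<open>n = 0\<close>.\<close>

definition padic_val :: "(nat \<Rightarrow> int) \<Rightarrow> nat" where
  "padic_val x = (GREATEST n. x n = 0)"

definition padic_norm :: "nat \<Rightarrow> (nat \<Rightarrow> int) \<Rightarrow> real" where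
  "padic_norm p x = (if \<forall>n. x n = 0 then 0 else real p powi (- int (padic_val x)))"

definition padic_dist :: "nat \<Rightarrow> (nat \<Rightarrow> int) \<Rightarrow> (nat \<Rightarrow> int) \<Rightarrow> real" where
  "padic_dist p x y = padic_norm p (padic_diff p x y)"

definition padic_topology :: "nat \<Rightarrow> (nat \<Rightarrow> int) topology" where
  "padic_topology p = Metric_space.mtopology (padic_ints p) (padic_dist p)"

lemma padic_of_int_in: "p \<ge> 2 \<Longrightarrow> padic_of_int p k \<in> padic_ints p"
  by (auto simp: padic_ints_def padic_of_int_def mod_mod_cancel)

lemma padic_ints_mod:
  assumes "x \<in> padic_ints p" "m \<le> n"
  shows "x n mod int p ^ m = x m"
  using \<open>m \<le> n\<close>
proof (induction n rule: dec_induct)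
  case base
  then show ?case using assms(1) by (auto simp: padic_ints_def)
next
  case (step n)
  have "x (Suc n) mod int p ^ m = (x (Suc n) mod int p ^ n) mod int p ^ m"
    using step.hyps by (simp add: mod_mod_cancel le_imp_power_dvd)
  also have "\<dots> = x n mod int p ^ m"
    using assms(1) by (simp add: padic_ints_def)
  finally show ?case using step.IH by simp
qed

lemma padic_diff_in:
  assumes "p \<ge> 2" "x \<in> padic_ints p" "y \<in> padic_ints p"
  shows "padic_diff p x y \<in> padic_ints p"
proof -
  have "(x (Suc n) - y (Suc n)) mod int p ^ Suc n mod int p ^ n = (x n - y n) mod int p ^ n" for n
  proof -
    have "(x (Suc n) - y (Suc n)) mod int p ^ Suc n mod int p ^ n
        = (x (Suc n) - y (Suc n)) mod int p ^ n"
      by (simp add: mod_mod_cancel)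
    also have "\<dots> = (x (Suc n) mod int p ^ n - y (Suc n) mod int p ^ n) mod int p ^ n"
      by (simp add: mod_diff_eq)
    finally show ?thesis using assms by (simp add: padic_ints_def)
  qed
  then show ?thesis using assms(1) by (auto simp: padic_ints_def padic_diff_def)
qed

lemma padic_norm_nonneg: "padic_norm p x \<ge> 0"
  by (simp add: padic_norm_def)

lemma padic_norm_le_iff:
  assumes p: "p \<ge> 2" and x: "x \<in> padic_ints p"
  shows "padic_norm p x \<le> real p powi (- int n) \<longleftrightarrow> x n = 0"
proof (cases "\<forall>n. x n = 0")
  case True
  then show ?thesis by (simp add: padic_norm_def)
next
  case False
  then obtain m where m: "x m \<noteq> 0" by blast
  have down: "x i = 0" if "x j = 0" "i \<le> j" for i j
    using padic_ints_mod[OF x \<open>i \<le> j\<close>] that by simp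
  have bnd: "i \<le> m" if "x i = 0" for i
    using down[OF that, of m] m by (meson nle_le)
  have x0: "x 0 = 0" using x by (auto simp: padic_ints_def dest!: spec[of _ 0])
  have v: "x (padic_val x) = 0"
    unfolding padic_val_def by (rule GreatestI_nat[of _ 0 m]) (use x0 bnd in auto)
  have "x n = 0 \<longleftrightarrow> n \<le> padic_val x"
    using down[OF v] Greatest_le_nat[of "\<lambda>n. x n = 0" n m] bnd
    by (auto simp: padic_val_def)
  moreover have "real p powi (- int (padic_val x)) \<le> real p powi (- int n) \<longleftrightarrow> n \<le> padic_val x"
    using p by (simp add: power_int_minus)
  ultimately show ?thesis using m by (auto simp: padic_norm_def)
qed

lemma padic_dist_le_iff:
  assumes "p \<ge> 2" "x \<in> padic_ints p" "y \<in> padic_ints p"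
  shows "padic_dist p x y \<le> real p powi (- int n) \<longleftrightarrow> x n = y n"
proof -
  have "(x n - y n) mod int p ^ n = 0 \<longleftrightarrow> x n mod int p ^ n = y n mod int p ^ n"
    by (metis mod_eq_dvd_iff dvd_eq_mod_eq_0)
  also have "\<dots> \<longleftrightarrow> x n = y n"
    using assms by (simp add: padic_ints_mod)
  finally show ?thesis
    using padic_norm_le_iff[OF assms(1) padic_diff_in[OF assms]]
    by (simp add: padic_dist_def padic_diff_def)
qed

lemma padic_dist_values:
  "padic_dist p x y = 0 \<or> (\<exists>n. padic_dist p x y = real p powi (- int n))"
  by (auto simp: padic_dist_def padic_norm_def)

lemma padic_dist_commute: "padic_dist p x y = padic_dist p y x"
proof -
  have "padic_diff p x y n = 0 \<longleftrightarrow> padic_diff p y x n = 0" for n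
    by (simp add: padic_diff_def flip: dvd_eq_mod_eq_0) (metis dvd_minus_iff minus_diff_eq)
  then show ?thesis by (simp add: padic_dist_def padic_norm_def padic_val_def)
qed

lemma padic_dist_eq_0_iff:
  assumes "p \<ge> 2" "x \<in> padic_ints p" "y \<in> padic_ints p"
  shows "padic_dist p x y = 0 \<longleftrightarrow> x = y"
proof
  assume "padic_dist p x y = 0"
  then have "padic_dist p x y \<le> real p powi (- int n)" for n by simp
  then show "x = y" using padic_dist_le_iff[OF assms] by blast
qed (simp add: padic_dist_def padic_norm_def padic_diff_def)

lemma padic_dist_ultrametric:
  assumes "p \<ge> 2" "x \<in> padic_ints p" "y \<in> padic_ints p" "z \<in> padic_ints p"
  shows "padic_dist p x z \<le> max (padic_dist p x y) (padic_dist p y z)" (is "_ \<le> ?M")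
proof -
  have "?M = 0 \<or> (\<exists>n. ?M = real p powi (- int n))"
    using padic_dist_values[of p x y] padic_dist_values[of p y z] by (auto simp: max_def)
  then show ?thesis
  proof
    assume "?M = 0"
    then have "padic_dist p x y = 0" "padic_dist p y z = 0"
      using padic_norm_nonneg by (metis max.cobounded1 max.cobounded2 order_antisym padic_dist_def)+
    then show ?thesis using assms padic_dist_eq_0_iff by simp
  next
    assume "\<exists>n. ?M = real p powi (- int n)"
    then obtain n where n: "?M = real p powi (- int n)" ..
    then have "x n = y n" "y n = z n"
      using assms by (auto simp flip: padic_dist_le_iff)
    then show ?thesis using assms n padic_dist_le_iff[of p x z n] by simp
  qed
qed

lemma Metric_space_padic: "p \<ge> 2 \<Longrightarrow> Metric_space (padic_ints p) (padic_dist p)"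
proof
  fix x y z assume "p \<ge> 2" "x \<in> padic_ints p" "y \<in> padic_ints p" "z \<in> padic_ints p"
  then show "padic_dist p x z \<le> padic_dist p x y + padic_dist p y z"
    using padic_dist_ultrametric[of p x y z] padic_norm_nonneg[of p]
    by (smt (verit) padic_dist_def)
qed (simp_all add: padic_dist_eq_0_iff, simp_all add: padic_dist_commute, simp add: padic_dist_def padic_norm_nonneg)


section \<open>The $p$-ary rooted tree and its tilings\<close>

type_synonym word = "nat list"

definition words :: "nat \<Rightarrow> word set" where
  "words p = lists {..<p}"

text \<open>Edges are directed away from the root.\<close>

definition full_tree :: "nat \<Rightarrow> word pair_pre_digraph" where
  "full_tree p = \<lparr>pverts = words p, parcs = {(w, w @ [c]) | w c. w \<in> words p \<and> c < p}\<rparr>"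

text \<open>
  \<open>Digraph_Component.connected\<close> refers to the underlying undirected graph
  and entails that there is at least one vertex.
\<close>

definition subtree :: "nat \<Rightarrow> word pair_pre_digraph \<Rightarrow> bool" where
  "subtree p S \<longleftrightarrow>
     subgraph (with_proj S) (with_proj (full_tree p)) \<and> Digraph_Component.connected (with_proj S)"

definition leaves :: "word pair_pre_digraph \<Rightarrow> word set" where
  "leaves S = {v \<in> pverts S. \<forall>c. v @ [c] \<notin> pverts S}"

definition translate :: "word \<Rightarrow> word pair_pre_digraph \<Rightarrow> word pair_pre_digraph" where
  "translate w S = \<lparr>pverts = (\<lambda>v. w @ v) ` pverts S,
                    parcs = (\<lambda>(v, v'). (w @ v, w @ v')) ` parcs S\<rparr>"

definition tiling :: "nat \<Rightarrow> word pair_pre_digraph \<Rightarrow> word set \<Rightarrow> bool" where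
  "tiling p S \<Omega> \<longleftrightarrow>
     subtree p S \<and> finite (pverts S) \<and> parcs S \<noteq> {} \<and> \<Omega> \<subseteq> words p \<and>
     (\<forall>v \<in> pverts (full_tree p). \<exists>\<omega>\<in>\<Omega>. v \<in> pverts (translate \<omega> S)) \<and>
     (\<forall>e \<in> parcs (full_tree p). \<exists>\<omega>\<in>\<Omega>. e \<in> parcs (translate \<omega> S)) \<and>
     (\<forall>\<omega>\<in>\<Omega>. \<forall>\<omega>'\<in>\<Omega>. \<omega> \<noteq> \<omega>' \<longrightarrow> parcs (translate \<omega> S) \<inter> parcs (translate \<omega>' S) = {})"

definition tile :: "nat \<Rightarrow> word pair_pre_digraph \<Rightarrow> bool" where
  "tile p S \<longleftrightarrow> (\<exists>\<Omega>. tiling p S \<Omega>)"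

definition leaf_words :: "word pair_pre_digraph \<Rightarrow> nat \<Rightarrow> word set" where
  "leaf_words S n = {concat ls | ls. length ls = n \<and> set ls \<subseteq> leaves S}"


section \<open>The $p$-adic ball of a word\<close>

definition word_val :: "nat \<Rightarrow> word \<Rightarrow> nat" where
  "word_val p w = (\<Sum>i<length w. w ! i * p ^ i)"

definition word_ball :: "nat \<Rightarrow> word \<Rightarrow> (nat \<Rightarrow> int) set" where
  "word_ball p w = {x \<in> padic_ints p.
     padic_norm p (padic_diff p x (padic_of_int p (int (word_val p w))))
       < real p powi (- int (length w) + 1)}"

end

theory Submission
  imports Defs "HOL-Library.Sublist"
begin

text \<open>
  Reading a \<open>p\<close>-adic integer as its infinite expansion in base \<open>p\<close> identifies \<open>\<int>\<^sub>p\<close> with the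
  boundary of the tree \<open>T\<^sub>p\<close>, and the ball of a word \<open>w\<close> becomes the set of points whose expansion
  begins with \<open>w\<close> (\<open>word_ball_eq\<close>). Everything then rests on one combinatorial fact: the leaves of a
  tile form a complete prefix code (\<open>tile_leaves_code\<close>), that is, every long enough word begins with
  exactly one leaf. The reason is that a tile contains the root together with all its children, so if
  a vertex of the tile had some but not all of its children, the translate covering a missing edge
  would have to share another edge with the tile.

  Consequently each \<open>p\<close>-adic integer is parsed in one and only one way as an infinite concatenation
  of leaves, and every infinite sequence of leaves arises (\<open>blocks\<close>, \<open>realize_blocks\<close>). The balls of
  the words in \<open>L\<^sub>n(S)\<close> collect the points with the same first \<open>n\<close> leaves, so they partition \<open>\<int>\<^sub>p\<close>,
  and inclusion of balls is extension of lists of leaves (\<open>ball_subset_iff\<close>), a relation that a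
  bijection of the leaves preserves. Replacing each leaf \<open>\<ell>\<close> in the parsing of \<open>x\<close> by \<open>f \<ell>\<close> gives
  the parsing of \<open>\<phi> x\<close>. The first \<open>n\<close> leaves of \<open>x\<close> depend on boundedly many digits
  (\<open>blocks_cong\<close>), and they determine at least \<open>n\<close> digits since leaves are nonempty
  (\<open>blocks_separate\<close>); hence \<open>\<phi>\<close> is continuous. Its inverse is the map built in the same way from
  the inverse of \<open>f\<close>.

  Tiles with equally many leaves exist because a tile of \<open>T\<^sub>p\<close> with \<open>m\<close> internal vertices has
  \<open>m * (p - 1) + 1\<close> leaves: take \<open>m = q - 1\<close> in \<open>T\<^sub>p\<close> and \<open>m = p - 1\<close> in \<open>T\<^sub>q\<close>. Comb-shaped trees show
  that each \<open>m > 0\<close> occurs.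
\<close>

section \<open>Digits of a p-adic integer\<close>

lemma word_val_Nil [simp]: "word_val p [] = 0"
  by (simp add: word_val_def)

lemma word_val_snoc: "word_val p (w @ [c]) = word_val p w + c * p ^ length w"
  by (simp add: word_val_def nth_append)

lemma words_Nil [simp]: "[] \<in> words p"
  by (simp add: words_def)

lemma words_Cons [simp]: "c # w \<in> words p \<longleftrightarrow> c < p \<and> w \<in> words p"
  by (auto simp: words_def)

lemma words_append [simp]: "u @ v \<in> words p \<longleftrightarrow> u \<in> words p \<and> v \<in> words p"
  by (auto simp: words_def)

lemma concat_words: "set ls \<subseteq> words p \<Longrightarrow> concat ls \<in> words p"
  by (induction ls) auto

lemma word_val_less:
  assumes "w \<in> words p"
  shows "word_val p w < p ^ length w"
  using assms
proof (induction w rule: rev_induct)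
  case (snoc c w)
  have "word_val p (w @ [c]) < p ^ length w + c * p ^ length w"
    using snoc by (simp add: word_val_snoc)
  also have "\<dots> = Suc c * p ^ length w" by simp
  also have "\<dots> \<le> p * p ^ length w"
    by (rule mult_le_mono1) (use snoc.prems in auto)
  finally show ?case by simp
qed simp

lemma word_val_inj:
  assumes "u \<in> words p" "v \<in> words p" "length u = length v" "word_val p u = word_val p v"
  shows "u = v"
  using assms
proof (induction u arbitrary: v rule: rev_induct)
  case (snoc c u)
  obtain v' d where v: "v = v' @ [d]"
    using snoc.prems(3) by (cases v rule: rev_cases) auto
  have len: "length v' = length u" using snoc.prems v by simp
  have less: "word_val p u < p ^ length u" "word_val p v' < p ^ length u"
    using word_val_less[of u p] word_val_less[of v' p] snoc.prems v len by auto
  have eq: "word_val p u + c * p ^ length u = word_val p v' + d * p ^ length u"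
    using snoc.prems v len by (simp add: word_val_snoc)
  have "word_val p u = word_val p v'"
    using arg_cong[OF eq, of "\<lambda>k. k mod p ^ length u"] less by simp
  moreover have "p > 0" using snoc.prems(1) by auto
  with \<open>word_val p u = word_val p v'\<close> eq have "c = d" by simp
  ultimately show ?case using snoc v len by auto
qed simp

text \<open>
  The first \<open>k\<close> digits of the expansion, least significant first, so that they spell the path of
  \<open>x\<close> in the tree.
\<close>

definition digits :: "nat \<Rightarrow> (nat \<Rightarrow> int) \<Rightarrow> nat \<Rightarrow> word" where
  "digits p x k = map (\<lambda>i. nat (x (Suc i) div int p ^ i)) [0..<k]"

lemma length_digits [simp]: "length (digits p x k) = k"
  by (simp add: digits_def)

lemma take_digits: "j \<le> k \<Longrightarrow> take j (digits p x k) = digits p x j"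
  by (simp add: digits_def take_map)

lemma digits_words:
  assumes "x \<in> padic_ints p"
  shows "digits p x k \<in> words p"
proof -
  have "nat (x (Suc i) div int p ^ i) < p" for i
  proof -
    have "x (Suc i) < int p * int p ^ i" "0 \<le> x (Suc i)" "0 < int p"
      using assms by (auto simp: padic_ints_def dest!: spec[of _ "Suc i"] intro!: Nat.gr0I)
    moreover have "x (Suc i) div int p ^ i * int p ^ i \<le> x (Suc i)"
      using \<open>0 < int p\<close> by (metis minus_mod_eq_div_mult pos_mod_sign zero_less_power diff_le_self le_add_same_cancel1 diff_add_cancel)
    ultimately have "x (Suc i) div int p ^ i * int p ^ i < int p * int p ^ i" by linarith
    then have "x (Suc i) div int p ^ i < int p" by (rule mult_right_less_imp_less) simp
    then show ?thesis using \<open>0 < int p\<close> by simp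
  qed
  then show ?thesis by (auto simp: digits_def words_def)
qed

lemma word_val_digits:
  assumes x: "x \<in> padic_ints p"
  shows "int (word_val p (digits p x k)) = x k"
proof (induction k)
  case 0
  then show ?case using x by (auto simp: padic_ints_def digits_def dest!: spec[of _ 0])
next
  case (Suc k)
  have "0 \<le> x (Suc k)" "x (Suc k) mod int p ^ k = x k"
    using x by (auto simp: padic_ints_def)
  moreover have "digits p x (Suc k) = digits p x k @ [nat (x (Suc k) div int p ^ k)]"
    by (simp add: digits_def)
  ultimately show ?case
    using Suc mod_mult_div_eq[of "x (Suc k)" "int p ^ k"]
    by (simp add: word_val_snoc pos_imp_zdiv_nonneg_iff div_int_pos_iff mult.commute)
qed

lemma digits_eq_iff:
  assumes "x \<in> padic_ints p" "y \<in> padic_ints p"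
  shows "digits p x k = digits p y k \<longleftrightarrow> x k = y k"
proof
  show "digits p x k = digits p y k \<Longrightarrow> x k = y k"
    using word_val_digits[OF assms(1), of k] word_val_digits[OF assms(2), of k] by simp
  show "x k = y k \<Longrightarrow> digits p x k = digits p y k"
    using word_val_digits[OF assms(1), of k] word_val_digits[OF assms(2), of k]
      word_val_inj[OF digits_words[OF assms(1)] digits_words[OF assms(2)], of k k] by simp
qed

text \<open>
  The norm takes only the value 0 and integral powers of \<open>p\<close>, so that the open ball of radius
  \<open>p\<^bsup>-n+1\<^esup>\<close> is the closed ball of radius \<open>p\<^bsup>-n\<^esup>\<close>, a residue class modulo \<open>p\<^bsup>n\<^esup>\<close>.
\<close>

lemma padic_norm_less_iff:
  assumes "p \<ge> 2"
  shows "padic_norm p x < real p powi (- int n + 1) \<longleftrightarrow> padic_norm p x \<le> real p powi (- int n)"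
proof (cases "\<forall>n. x n = 0")
  case False
  have "a < b \<Longrightarrow> real p powi a < real p powi b" "a \<le> b \<Longrightarrow> real p powi a \<le> real p powi b" for a b
    using assms by (auto intro: power_int_strict_increasing power_int_increasing)
  then have "real p powi a < real p powi b \<longleftrightarrow> a < b" "real p powi a \<le> real p powi b \<longleftrightarrow> a \<le> b" for a b
    by (meson not_le)+
  with False show ?thesis by (auto simp: padic_norm_def)
qed (use assms in \<open>simp add: padic_norm_def\<close>)

lemma word_ball_eq:
  assumes p: "p \<ge> 2" and w: "w \<in> words p"
  shows "word_ball p w = {x \<in> padic_ints p. digits p x (length w) = w}"
proof -
  have "padic_norm p (padic_diff p x (padic_of_int p (int (word_val p w))))
          < real p powi (- int (length w) + 1) \<longleftrightarrow> digits p x (length w) = w"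
    if x: "x \<in> padic_ints p" for x
  proof -
    let ?N = "int (word_val p w)"
    have "padic_norm p (padic_diff p x (padic_of_int p ?N)) < real p powi (- int (length w) + 1)
        \<longleftrightarrow> x (length w) = padic_of_int p ?N (length w)"
      using padic_norm_less_iff[OF p] padic_dist_le_iff[OF p x padic_of_int_in[OF p]]
      by (simp add: padic_dist_def)
    also have "padic_of_int p ?N (length w) = ?N"
      using word_val_less[OF w] by (simp add: padic_of_int_def flip: of_nat_power of_nat_mod)
    also have "x (length w) = ?N \<longleftrightarrow> digits p x (length w) = w"
      using word_val_digits[OF x, of "length w"] word_val_inj[OF digits_words[OF x] w]
      by (metis length_digits of_nat_eq_iff)
    finally show ?thesis .
  qed
  then show ?thesis by (auto simp: word_ball_def)
qed

text \<open>
  The completeness of \<open>\<int>\<^sub>p\<close>, in the form in which points of intersections of nested balls are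
  produced.
\<close>

lemma padic_of_digits:
  assumes p: "p \<ge> 2" and d: "\<And>i. d i < p"
  shows "\<exists>x\<in>padic_ints p. \<forall>k. digits p x k = map d [0..<k]"
proof -
  define x where "x k = int (word_val p (map d [0..<k]))" for k
  have w: "map d [0..<k] \<in> words p" for k using d by (auto simp: words_def)
  have less: "word_val p (map d [0..<k]) < p ^ k" for k
    using word_val_less[OF w, of k] by simp
  have "x (Suc k) mod int p ^ k = x k" for k
    using less[of k] by (simp add: x_def word_val_snoc flip: of_nat_power of_nat_mod of_nat_mult of_nat_add)
  then have x: "x \<in> padic_ints p"
    using less by (auto simp: padic_ints_def x_def simp flip: of_nat_power)
  have "digits p x k = map d [0..<k]" for k
    using word_val_inj[OF digits_words[OF x] w] word_val_digits[OF x] unfolding x_def by simp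
  with x show ?thesis by blast
qed

lemma word_ball_nonempty:
  assumes p: "p \<ge> 2" and w: "w \<in> words p"
  shows "word_ball p w \<noteq> {}"
proof -
  have "(if i < length w then w ! i else 0) < p" for i
    using p w by (auto simp: words_def in_lists_conv_set)
  then obtain x where x: "x \<in> padic_ints p"
      "\<And>k. digits p x k = map (\<lambda>i. if i < length w then w ! i else 0) [0..<k]"
    using padic_of_digits[OF p, of "\<lambda>i. if i < length w then w ! i else 0"] by blast
  have "digits p x (length w) = w" unfolding x(2) by (rule nth_equalityI) auto
  then show ?thesis using x(1) word_ball_eq[OF p w] by auto
qed

section \<open>Complete prefix codes and the parsing of p-adic integers\<close>

definition code_lists :: "'a set \<Rightarrow> nat \<Rightarrow> 'a list set" where
  "code_lists L n = {ls. length ls = n \<and> set ls \<subseteq> L}"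

text \<open>
  The bound \<open>N\<close> plays the role of finiteness of \<open>L\<close>: no codeword is longer than \<open>N\<close>, because its
  prefix of length \<open>N\<close> would begin with another codeword. Keeping \<open>N\<close> explicit gives a modulus of
  continuity for the parsing of \<open>p\<close>-adic integers.
\<close>

locale complete_code =
  fixes p :: nat and L :: "word set" and N :: nat
  assumes p2: "p \<ge> 2"
    and L_words: "L \<subseteq> words p"
    and Nil_notin: "[] \<notin> L"
    and prefix_free: "u \<in> L \<Longrightarrow> v \<in> L \<Longrightarrow> prefix u v \<Longrightarrow> u = v"
    and complete: "w \<in> words p \<Longrightarrow> length w = N \<Longrightarrow> \<exists>l\<in>L. prefix l w"
begin

lemma concat_code_words: "ls \<in> code_lists L n \<Longrightarrow> concat ls \<in> words p"
  using L_words by (auto simp: code_lists_def intro!: concat_words)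

lemma length_concat_code: "ls \<in> code_lists L n \<Longrightarrow> n \<le> length (concat ls)"
proof (induction ls arbitrary: n)
  case (Cons l ls)
  then have "length ls \<le> length (concat ls)" "l \<noteq> []"
    using Nil_notin by (auto simp: code_lists_def)
  moreover from this(2) have "1 \<le> length l" by (cases l) auto
  ultimately show ?case using Cons.prems by (simp add: code_lists_def)
qed (simp add: code_lists_def)

text \<open>
  Codewords have length at most \<open>N\<close>, so splitting off one of them uses up at most \<open>N\<close> letters.
\<close>

lemma parse_exists:
  assumes "w \<in> words p" "length w = n * N"
  shows "\<exists>ls\<in>code_lists L n. prefix (concat ls) w"
proof -
  have "\<exists>ls\<in>code_lists L n. prefix (concat ls) w" if "w \<in> words p" "n * N \<le> length w" for w
    using that
  proof (induction n arbitrary: w)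
    case (Suc n)
    have "take N w \<in> words p" using Suc.prems by (metis append_take_drop_id words_append)
    moreover have "length (take N w) = N" using Suc.prems by simp
    ultimately obtain l where l: "l \<in> L" "prefix l (take N w)" using complete by blast
    then obtain v where v: "w = l @ v" by (metis append_take_drop_id prefixE append_assoc)
    have "length l \<le> N" using prefix_length_le[OF l(2)] by simp
    then have "n * N \<le> length v" "v \<in> words p" using Suc.prems v by auto
    then obtain ls where "ls \<in> code_lists L n" "prefix (concat ls) v" using Suc.IH by blast
    then show ?case using l v by (intro bexI[of _ "l # ls"]) (auto simp: code_lists_def)
  qed (simp add: code_lists_def)
  then show ?thesis using assms by simp
qed

text \<open>
  Two codewords beginning the same word are comparable, hence equal; so two factorisations of a word
  agree codeword by codeword as far as the shorter one reaches.
\<close>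

lemma parse_unique:
  assumes "ls \<in> code_lists L n" "ks \<in> code_lists L m" "n \<le> m"
    and "prefix (concat ls) w" "prefix (concat ks) w"
  shows "take n ks = ls"
  using assms
proof (induction ls arbitrary: ks n m w)
  case (Cons l ls)
  obtain k ks' where ks: "ks = k # ks'"
    using Cons.prems by (cases ks) (auto simp: code_lists_def)
  have "prefix l w" "prefix k w"
    using Cons.prems ks by (auto dest: append_prefixD)
  then have "l = k"
    using Cons.prems ks prefix_free prefix_same_cases[of l w k] by (auto simp: code_lists_def)
  moreover obtain v where "w = l @ v" using \<open>prefix l w\<close> by (auto elim: prefixE)
  ultimately have "prefix (concat ls) v" "prefix (concat ks') v"
    using Cons.prems ks by auto
  then have "take (n - 1) ks' = ls"
    using Cons.prems ks by (intro Cons.IH[of _ _ "m - 1"]) (auto simp: code_lists_def)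
  then show ?case using \<open>l = k\<close> ks Cons.prems by (cases n) (auto simp: code_lists_def)
qed (simp add: code_lists_def)

lemma concat_inj: "inj_on concat (code_lists L n)"
proof (rule inj_onI)
  fix ls ks assume "ls \<in> code_lists L n" "ks \<in> code_lists L n" "concat ls = concat ks"
  then show "ls = ks" using parse_unique[of ls n ks n "concat ks"] by (simp add: code_lists_def)
qed

definition blocks :: "nat \<Rightarrow> (nat \<Rightarrow> int) \<Rightarrow> word list" where
  "blocks n x = (THE ls. ls \<in> code_lists L n \<and> x \<in> word_ball p (concat ls))"

lemma in_ball_iff:
  assumes "ls \<in> code_lists L n" "x \<in> padic_ints p"
  shows "x \<in> word_ball p (concat ls) \<longleftrightarrow> digits p x (length (concat ls)) = concat ls"
  using assms word_ball_eq[OF p2 concat_code_words] by auto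

lemma in_ball_prefix:
  assumes "ls \<in> code_lists L n" "x \<in> word_ball p (concat ls)" "length (concat ls) \<le> k"
  shows "prefix (concat ls) (digits p x k)"
proof -
  have "digits p x (length (concat ls)) = concat ls"
    using assms word_ball_eq[OF p2 concat_code_words] by auto
  then show ?thesis using take_digits[OF assms(3)] take_is_prefix by metis
qed

lemma balls_take:
  assumes "ls \<in> code_lists L n" "ks \<in> code_lists L m" "n \<le> m"
    and "x \<in> word_ball p (concat ls)" "x \<in> word_ball p (concat ks)"
  shows "take n ks = ls"
  by (rule parse_unique[OF assms(1-3) in_ball_prefix[OF assms(1,4) max.cobounded1]
        in_ball_prefix[OF assms(2,5) max.cobounded2]])

lemma prefix_in_ball:
  assumes "ls \<in> code_lists L n" "x \<in> padic_ints p" "prefix (concat ls) (digits p x k)"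
  shows "x \<in> word_ball p (concat ls)"
proof -
  have "length (concat ls) \<le> k" using prefix_length_le[OF assms(3)] by simp
  then have "digits p x (length (concat ls)) = concat ls"
    using assms(3) take_digits by (metis append_eq_conv_conj prefixE)
  then show ?thesis using in_ball_iff[OF assms(1,2)] by simp
qed

lemma blocksI:
  assumes "ls \<in> code_lists L n" "x \<in> word_ball p (concat ls)"
  shows "blocks n x = ls"
  unfolding blocks_def
proof (rule the_equality)
  fix ks assume "ks \<in> code_lists L n \<and> x \<in> word_ball p (concat ks)"
  then show "ks = ls" using balls_take[OF assms(1) _ order_refl assms(2)] by (auto simp: code_lists_def)
qed (use assms in blast)

lemma blocks:
  assumes "x \<in> padic_ints p"
  shows "blocks n x \<in> code_lists L n" "x \<in> word_ball p (concat (blocks n x))"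
    "prefix (concat (blocks n x)) (digits p x (n * N))"
proof -
  obtain ls where "ls \<in> code_lists L n" "prefix (concat ls) (digits p x (n * N))"
    using parse_exists[OF digits_words[OF assms], of "n * N"] by auto
  then show "blocks n x \<in> code_lists L n" "x \<in> word_ball p (concat (blocks n x))"
    "prefix (concat (blocks n x)) (digits p x (n * N))"
    using prefix_in_ball[OF _ assms] blocksI by auto
qed

lemma in_ball_blocks_iff:
  assumes "x \<in> padic_ints p" "ls \<in> code_lists L n"
  shows "x \<in> word_ball p (concat ls) \<longleftrightarrow> blocks n x = ls"
  using blocks(2)[OF assms(1), of n] blocksI[OF assms(2)] by auto

lemma take_blocks:
  assumes "x \<in> padic_ints p" "n \<le> m"
  shows "take n (blocks m x) = blocks n x"
  by (rule balls_take[OF blocks(1)[OF assms(1)] blocks(1)[OF assms(1)] assms(2)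
        blocks(2)[OF assms(1)] blocks(2)[OF assms(1)]])

text \<open>
  Together with \<open>blocks_separate\<close> this says that the partitions by digits and by codewords refine
  each other, which is the only way in which the metric enters the continuity proof.
\<close>

lemma blocks_cong:
  assumes "x \<in> padic_ints p" "y \<in> padic_ints p" "x (n * N) = y (n * N)"
  shows "blocks n x = blocks n y"
proof -
  have "digits p x (n * N) = digits p y (n * N)" using assms digits_eq_iff by blast
  then have "y \<in> word_ball p (concat (blocks n x))"
    using prefix_in_ball blocks[OF assms(1), of n] assms(2) by metis
  then show ?thesis using blocksI blocks(1)[OF assms(1)] by metis
qed

lemma blocks_separate:
  assumes x: "x \<in> padic_ints p" and y: "y \<in> padic_ints p" and eq: "blocks n x = blocks n y"
  shows "x n = y n"
proof -
  have *: "digits p z n = take n (concat (blocks n z))" if "z \<in> padic_ints p" for z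
    using in_ball_iff[OF blocks(1)[OF that, of n] that] blocks(2)[OF that, of n]
      take_digits[OF length_concat_code[OF blocks(1)[OF that, of n]], of p z] by simp
  show ?thesis using * x y eq digits_eq_iff by metis
qed

text \<open>
  The lists \<open>b n\<close> extend each other and spell words of unbounded length, as codewords are not empty.
  The digits of the limit can therefore be read off from them.
\<close>

lemma realize_blocks:
  assumes b: "\<And>n. b n \<in> code_lists L n" "\<And>n. take n (b (Suc n)) = b n"
  shows "\<exists>x\<in>padic_ints p. \<forall>n. blocks n x = b n"
proof -
  define d where "d i = concat (b (Suc i)) ! i" for i
  have len: "n \<le> length (concat (b n))" for n using length_concat_code b by blast
  have pre: "prefix (concat (b n)) (concat (b m))" if "n \<le> m" for n m
    using that
  proof (induction m rule: dec_induct)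
    case (step m)
    have "concat (b (Suc m)) = concat (b m) @ concat (drop m (b (Suc m)))"
      using b(2)[of m] by (metis append_take_drop_id concat_append)
    then show ?case using step.IH by (metis prefix_prefix)
  qed simp
  have nth: "d i = concat (b n) ! i" if "i < length (concat (b n))" for i n
    using pre[of "Suc i" n] pre[of n "Suc i"] len[of "Suc i"] that
    by (cases "Suc i \<le> n") (auto simp: d_def prefix_def nth_append)
  have "d i < p" for i
  proof -
    have "d i \<in> set (concat (b (Suc i)))"
      unfolding d_def using len[of "Suc i"] by (intro nth_mem) simp
    then show ?thesis
      using concat_code_words[OF b(1)[of "Suc i"]] by (auto simp: words_def)
  qed
  then obtain x where x: "x \<in> padic_ints p" "\<And>k. digits p x k = map d [0..<k]"
    using padic_of_digits[OF p2, of d] by blast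
  have "digits p x (length (concat (b n))) = concat (b n)" for n
    using nth unfolding x(2) by (intro nth_equalityI) auto
  then have "blocks n x = b n" for n
    using blocksI b in_ball_iff x by metis
  then show ?thesis using x by blast
qed

text \<open>
  A point common to both balls has both lists as initial parts of its parsing.
\<close>

lemma ball_subset_iff:
  assumes ls: "ls \<in> code_lists L n" and ks: "ks \<in> code_lists L m" and "n \<le> m"
  shows "word_ball p (concat ks) \<subseteq> word_ball p (concat ls) \<longleftrightarrow> take n ks = ls"
proof
  assume sub: "word_ball p (concat ks) \<subseteq> word_ball p (concat ls)"
  obtain x where x: "x \<in> word_ball p (concat ks)"
    using word_ball_nonempty[OF p2 concat_code_words[OF ks]] by blast
  show "take n ks = ls" by (rule balls_take[OF assms subsetD[OF sub x] x])
next
  assume eq: "take n ks = ls"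
  show "word_ball p (concat ks) \<subseteq> word_ball p (concat ls)"
  proof
    fix x assume x: "x \<in> word_ball p (concat ks)"
    then have xp: "x \<in> padic_ints p" by (simp add: word_ball_def)
    then have "blocks n x = ls"
      using take_blocks[OF xp \<open>n \<le> m\<close>] blocksI[OF ks x] eq by simp
    then show "x \<in> word_ball p (concat ls)" using blocks(2)[OF xp, of n] by simp
  qed
qed

lemma ball_inj: "inj_on (word_ball p) (concat ` code_lists L n)"
proof (rule inj_onI)
  fix u v assume "u \<in> concat ` code_lists L n"
  then obtain ls where ls: "ls \<in> code_lists L n" "u = concat ls" by (rule imageE)
  assume "v \<in> concat ` code_lists L n"
  then obtain ks where ks: "ks \<in> code_lists L n" "v = concat ks" by (rule imageE)
  assume "word_ball p u = word_ball p v"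
  then have "take n ks = ls" using ball_subset_iff[OF ls(1) ks(1) order_refl] ls ks by simp
  moreover have "take n ks = ks" using ks by (simp add: code_lists_def)
  ultimately show "u = v" using ls ks by simp
qed

lemma ball_partition:
  "partition_on (padic_ints p) (word_ball p ` concat ` code_lists L n)"
proof (rule partition_onI)
  show "\<Union> (word_ball p ` concat ` code_lists L n) = padic_ints p"
  proof (intro equalityI subsetI)
    fix x assume "x \<in> padic_ints p"
    from blocks(2)[OF this] blocks(1)[OF this]
    show "x \<in> \<Union> (word_ball p ` concat ` code_lists L n)"
      by (intro UnionI[of "word_ball p (concat (blocks n x))"] imageI)
  qed (auto simp: word_ball_def)
  show "{} \<notin> word_ball p ` concat ` code_lists L n"
    using word_ball_nonempty[OF p2 concat_code_words] by (metis imageE)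
  fix A B assume "A \<in> word_ball p ` concat ` code_lists L n"
  then obtain ls where ls: "ls \<in> code_lists L n" "A = word_ball p (concat ls)" by (elim imageE) simp
  assume "B \<in> word_ball p ` concat ` code_lists L n"
  then obtain ks where ks: "ks \<in> code_lists L n" "B = word_ball p (concat ks)" by (elim imageE) simp
  assume "A \<noteq> B"
  have "ls = ks" if "x \<in> A" "x \<in> B" for x
    using that ls ks blocksI[of ls n x] blocksI[of ks n x] by simp
  then show "disjnt A B" using ls ks \<open>A \<noteq> B\<close> by (auto simp: disjnt_iff)
qed

end

section \<open>The leaves of a tile\<close>

text \<open>
  Tilings in terms of edges of \<open>S\<close> alone. The root of \<open>T\<^sub>p\<close> can only be covered by the root of
  the untranslated tile, whence the last two facts.
\<close>

lemma tilingD: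
  assumes "tiling p S \<Omega>"
  shows "finite (pverts S)" "pverts S \<subseteq> words p"
    and "u \<in> words p \<Longrightarrow> c < p \<Longrightarrow> \<exists>\<omega>\<in>\<Omega>. \<exists>s. u = \<omega> @ s \<and> (s, s @ [c]) \<in> parcs S"
    and "\<omega> \<in> \<Omega> \<Longrightarrow> \<omega>' \<in> \<Omega> \<Longrightarrow> (s, t) \<in> parcs S \<Longrightarrow> (s', t') \<in> parcs S \<Longrightarrow>
      \<omega> @ s = \<omega>' @ s' \<Longrightarrow> \<omega> @ t = \<omega>' @ t' \<Longrightarrow> \<omega> = \<omega>'"
    and "[] \<in> \<Omega>" "[] \<in> pverts S"
proof -
  note T = assms[unfolded tiling_def subtree_def subgraph_def, simplified]
  show "finite (pverts S)" "pverts S \<subseteq> words p"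
    using T by (auto simp: full_tree_def)
  show "\<exists>\<omega>\<in>\<Omega>. \<exists>s. u = \<omega> @ s \<and> (s, s @ [c]) \<in> parcs S" if "u \<in> words p" "c < p" for u c
  proof -
    have "(u, u @ [c]) \<in> parcs (full_tree p)" using that by (auto simp: full_tree_def)
    then obtain \<omega> where "\<omega> \<in> \<Omega>" "(u, u @ [c]) \<in> parcs (translate \<omega> S)" using T by blast
    then show ?thesis by (auto simp: translate_def intro!: bexI[of _ \<omega>])
  qed
  show "\<omega> = \<omega>'" if "\<omega> \<in> \<Omega>" "\<omega>' \<in> \<Omega>" "(s, t) \<in> parcs S" "(s', t') \<in> parcs S"
      "\<omega> @ s = \<omega>' @ s'" "\<omega> @ t = \<omega>' @ t'" for \<omega> \<omega>' s t s' t'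
  proof -
    have "(\<omega> @ s, \<omega> @ t) \<in> parcs (translate \<omega> S)"
      using that(3) by (force simp: translate_def)
    moreover have "(\<omega> @ s, \<omega> @ t) \<in> parcs (translate \<omega>' S)"
      using that(4) unfolding that(5,6) by (force simp: translate_def)
    ultimately show ?thesis using T that(1,2) by blast
  qed
  have "[] \<in> pverts (full_tree p)" by (simp add: full_tree_def)
  moreover have "\<forall>v\<in>pverts (full_tree p). \<exists>\<omega>\<in>\<Omega>. v \<in> pverts (translate \<omega> S)"
    using T by simp
  ultimately obtain \<omega>' where "\<omega>' \<in> \<Omega>" "[] \<in> pverts (translate \<omega>' S)" by blast
  then show "[] \<in> \<Omega>" "[] \<in> pverts S" by (auto simp: translate_def)
qed

lemma subtree_arcD:
  assumes "subtree p S" "(u, v) \<in> parcs S"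
  shows "u \<in> pverts S" "v \<in> pverts S" "\<exists>c<p. v = u @ [c]"
proof -
  have *: "wf_digraph (with_proj S)" "parcs S \<subseteq> parcs (full_tree p)"
    using assms(1) by (auto simp: subtree_def subgraph_def)
  show "u \<in> pverts S" "v \<in> pverts S"
    using wf_digraph.tail_in_verts[OF *(1)] wf_digraph.head_in_verts[OF *(1)] assms(2) by force+
  show "\<exists>c<p. v = u @ [c]" using *(2) assms(2) by (auto simp: full_tree_def)
qed

text \<open>
  A path in \<open>S\<close> from the root to \<open>u @ [c]\<close> has to enter the set of extensions of \<open>u @ [c]\<close>, and the
  only edge of \<open>T\<^sub>p\<close> that does so is the one from \<open>u\<close> to \<open>u @ [c]\<close>.
\<close>

lemma subtree_parent_arc:
  assumes S: "subtree p S" and root: "[] \<in> pverts S" and v: "u @ [c] \<in> pverts S"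
  shows "(u, u @ [c]) \<in> parcs S"
proof -
  have "[] \<rightarrow>\<^sup>*\<^bsub>with_proj (mk_symmetric (with_proj S))\<^esub> (u @ [c])"
    using S root v by (auto simp: subtree_def connected_def strongly_connected_def)
  then have "([], u @ [c]) \<in> (parcs (mk_symmetric (with_proj S)))\<^sup>*"
    using reachable_rtranclI by fastforce
  moreover have "prefix (u @ [c]) y \<longrightarrow> (u, u @ [c]) \<in> parcs S"
    if "([], y) \<in> (parcs (mk_symmetric (with_proj S)))\<^sup>*" for y
    using that
  proof (induction rule: rtrancl_induct)
    case (step x y)
    from step.hyps(2) consider "(x, y) \<in> parcs S" | "(y, x) \<in> parcs S"
      by (auto simp: parcs_mk_symmetric)
    then show ?case
    proof cases
      case 1
      with subtree_arcD(3)[OF S 1] step.IH show ?thesis by auto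
    next
      case 2
      with subtree_arcD(3)[OF S 2] step.IH show ?thesis by auto
    qed
  qed simp
  ultimately show ?thesis by simp
qed

text \<open>
  The crucial property of the tile is that a vertex with one child in \<open>S\<close> has all its children in
  \<open>S\<close>. Then the walk from the root along a word longer than the height of \<open>S\<close> can leave \<open>S\<close> only
  at a leaf.
\<close>

lemma tile_leaves_code:
  assumes "tile p S" and p: "p \<ge> 2"
  shows "\<exists>N. complete_code p (leaves S) N"
proof -
  obtain \<Omega> where "tiling p S \<Omega>" using assms(1) by (auto simp: tile_def)
  note T = tilingD[OF this]
  have S: "subtree p S" using \<open>tiling p S \<Omega>\<close> by (simp add: tiling_def)
  note arcD = subtree_arcD[OF S] and arcI = subtree_parent_arc[OF S T(6)]
  have closed: "u \<in> pverts S" if "u @ s \<in> pverts S" for u s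
    using that
  proof (induction s rule: rev_induct)
    case (snoc c s)
    then have "u @ s \<in> pverts S" using arcD(1)[OF arcI[of "u @ s" c]] by simp
    then show ?case by (rule snoc.IH)
  qed simp
  \<comment> \<open>Only the untranslated tile can cover the edges at the root.\<close>
  have root: "[c] \<in> pverts S" if "c < p" for c
    using T(3)[of "[]" c] that arcD(2) by force
  have full: "v @ [d] \<in> pverts S" if v: "v @ [c] \<in> pverts S" and "d < p" for v c d
  proof (rule ccontr)
    assume "v @ [d] \<notin> pverts S"
    have "v \<in> words p" "c < p" using v T(2) by auto
    then obtain \<omega> s where \<omega>: "\<omega> \<in> \<Omega>" "v = \<omega> @ s" "(s, s @ [d]) \<in> parcs S"
      using T(3) \<open>d < p\<close> by blast
    \<comment> \<open>The edge from \<open>\<omega>\<close> towards the child \<open>c\<close> of \<open>v\<close> belongs both to \<open>S\<close> and to its translate by \<open>\<omega>\<close>.\<close>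
    obtain a where a: "\<omega> @ [a] \<in> pverts S" "[a] \<in> pverts S"
    proof (cases s)
      case Nil
      then show thesis using that[of c] v \<omega> root \<open>c < p\<close> by simp
    next
      case (Cons a s')
      then show thesis
        using that[of a] closed[of "\<omega> @ [a]" "s' @ [c]"] closed[of "[a]" s'] v \<omega> arcD(1) by simp
    qed
    have "\<omega> = []"
      using T(4)[OF \<omega>(1) T(5) arcI[of "[]" a] arcI[OF a(1)]] a by simp
    then show False using \<omega> arcD(2) \<open>v @ [d] \<notin> pverts S\<close> by simp
  qed
  define N where "N = Suc (Max (length ` pverts S))"
  have N: "length v < N" if "v \<in> pverts S" for v
    using that T(1) by (auto simp: N_def less_Suc_eq_le)
  have "complete_code p (leaves S) N"
  proof
    show "leaves S \<subseteq> words p" using T(2) by (auto simp: leaves_def)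
    show "[] \<notin> leaves S" using root[of 0] p by (auto simp: leaves_def)
    show "u = v" if uv: "u \<in> leaves S" "v \<in> leaves S" "prefix u v" for u v
    proof -
      obtain s where s: "v = u @ s" using uv(3) by (auto elim: prefixE)
      show ?thesis
      proof (cases s)
        case (Cons c s')
        then have "u @ [c] \<in> pverts S" using closed[of "u @ [c]" s'] uv(2) s by (simp add: leaves_def)
        then show ?thesis using uv(1) by (simp add: leaves_def)
      qed (simp add: s)
    qed
    show "\<exists>l\<in>leaves S. prefix l w" if w: "w \<in> words p" "length w = N" for w
    proof -
      define k where "k = (LEAST k. take k w \<notin> pverts S)"
      have ex: "take N w \<notin> pverts S" using N[of w] w by auto
      have k: "take k w \<notin> pverts S" "k \<le> N"
        unfolding k_def using ex by (rule LeastI, intro Least_le)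
      have "k \<noteq> 0" using k(1) T(6) by (cases k) auto
      then obtain j where j: "k = Suc j" by (cases k) auto
      have "take j w \<in> pverts S"
        using not_less_Least[of j "\<lambda>k. take k w \<notin> pverts S"] j by (simp add: k_def)
      moreover have "take j w @ [c] \<notin> pverts S" for c
      proof
        assume "take j w @ [c] \<in> pverts S"
        moreover have "j < length w" using k(2) j w(2) by simp
        moreover from this have "w ! j < p" using w(1) by (auto simp: words_def in_lists_conv_set)
        ultimately have "take (Suc j) w \<in> pverts S" using full by (simp add: take_Suc_conv_app_nth)
        then show False using k(1) j by simp
      qed
      ultimately have "take j w \<in> leaves S" by (simp add: leaves_def)
      then show ?thesis using take_is_prefix by blast
    qed
  qed (use p in simp)
  then show ?thesis ..
qed

section \<open>Tiles with a prescribed number of leaves\<close>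

text \<open>
  The internal vertices are the words \<open>0\<^bsup>i\<^esup>\<close> with \<open>i < m\<close>, each with all its \<open>p\<close> children; all of
  them but the root occur among the words \<open>0\<^bsup>i\<^esup>c\<close>.
\<close>

definition comb :: "nat \<Rightarrow> nat \<Rightarrow> word pair_pre_digraph" where
  "comb p m = \<lparr>pverts = insert [] {replicate i 0 @ [c] | i c. i < m \<and> c < p},
               parcs = {(replicate i 0, replicate i 0 @ [c]) | i c. i < m \<and> c < p}\<rparr>"

lemma replicate_comb: "p > 0 \<Longrightarrow> i \<le> m \<Longrightarrow> replicate i 0 \<in> pverts (comb p m)"
  by (cases i) (auto simp: comb_def replicate_append_same[symmetric])

lemma replicate_words: "p > 0 \<Longrightarrow> replicate i 0 \<in> words p"
  by (auto simp: words_def)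

lemma comb_subtree:
  assumes "p > 0"
  shows "subtree p (comb p m)"
proof -
  let ?S = "with_proj (comb p m)" 
  let ?M = "with_proj (mk_symmetric ?S)"
  have wf: "wf_digraph ?S"
  proof
    fix e assume "e \<in> arcs ?S"
    then obtain i c where "e = (replicate i 0, replicate i 0 @ [c])" "i < m" "c < p"
      by (auto simp: comb_def)
    then show "tail ?S e \<in> verts ?S" "head ?S e \<in> verts ?S"
      using replicate_comb[OF assms, of i m] by (auto simp: comb_def)
  qed
  have wfF: "wf_digraph (with_proj (full_tree p))"
    by unfold_locales (auto simp: full_tree_def)
  have sub: "subgraph ?S (with_proj (full_tree p))"
    unfolding subgraph_def using wf wfF replicate_words[OF assms]
    by (auto simp: comb_def full_tree_def)
  interpret M: pair_wf_digraph "mk_symmetric ?S"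
    using wf by (rule wf_digraph.wellformed_mk_symmetric)
  have arc: "(replicate i 0, replicate i 0 @ [c]) \<in> parcs (mk_symmetric ?S)" if "i < m" "c < p" for i c
    using that by (force simp: parcs_mk_symmetric comb_def)
  have spine: "[] \<rightarrow>\<^sup>*\<^bsub>?M\<^esub> replicate i 0" if "i \<le> m" for i
    using that
  proof (induction i)
    case 0
    show ?case using M.reachable_refl[of "[]"] by (simp add: comb_def)
  next
    case (Suc i)
    then show ?case
      using M.reachable_adj_trans[OF _ arc[of i 0]] assms by (simp add: replicate_append_same)
  qed
  have to: "[] \<rightarrow>\<^sup>*\<^bsub>?M\<^esub> v" if v: "v \<in> pverts (comb p m)" for v
  proof (cases "v = []")
    case False
    then obtain i c where "v = replicate i 0 @ [c]" "i < m" "c < p"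
      using v by (auto simp: comb_def)
    then show ?thesis using M.reachable_adj_trans[OF spine[of i] arc[of i c]] by simp
  qed (use spine[of 0] in simp)
  have "u \<rightarrow>\<^sup>*\<^bsub>?M\<^esub> v" if "u \<in> pverts (comb p m)" "v \<in> pverts (comb p m)" for u v
    using M.reachable_trans[OF symmetric_reachable[OF symmetric_mk_symmetric to[OF that(1)]] to[OF that(2)]] .
  then have "Digraph_Component.connected ?S"
    by (auto simp: connected_def strongly_connected_def comb_def)
  with sub show ?thesis by (simp add: subtree_def)
qed

definition trailing_zeros :: "word \<Rightarrow> nat" where
  "trailing_zeros w = length (takeWhile (\<lambda>c. c = 0) (rev w))"

lemma trailing_zeros_append: "trailing_zeros (w @ replicate i 0) = i + trailing_zeros w"
proof -
  have "length (takeWhile (\<lambda>c. c = 0) (replicate i 0 @ xs))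
      = i + length (takeWhile (\<lambda>c. c = 0) xs)" for xs :: word
    by (induction i) auto
  then show ?thesis by (simp add: trailing_zeros_def)
qed

lemma trailing_zeros_decomp: "\<exists>u. w = u @ replicate (trailing_zeros w) 0"
proof -
  have "takeWhile (\<lambda>c. c = 0) (rev w) = replicate (trailing_zeros w) 0"
    unfolding trailing_zeros_def by (rule replicate_eqI) (auto dest: set_takeWhileD)
  then have "rev w = replicate (trailing_zeros w) 0 @ dropWhile (\<lambda>c. c = 0) (rev w)"
    by (metis takeWhile_dropWhile_id)
  then have "w = rev (dropWhile (\<lambda>c. c = 0) (rev w)) @ replicate (trailing_zeros w) 0"
    by (metis rev_append rev_replicate rev_rev_ident)
  then show ?thesis by blast
qed

text \<open>
  An edge is covered by a translate exactly if its end closer to the root lies at an internal vertex of that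
  translate. So the translations are to be chosen such that each word is, in just one way,
  a translation followed by fewer than \<open>m\<close> zeros; division with remainder of the number of trailing
  zeros by \<open>m\<close> shows that the words with a multiple of \<open>m\<close> trailing zeros do this.
\<close>

lemma comb_tile:
  assumes p: "p > 0" and m: "m > 0"
  shows "tile p (comb p m)"
proof -
  define \<Omega> where "\<Omega> = {w \<in> words p. m dvd trailing_zeros w}"
  have split: "\<exists>\<omega>\<in>\<Omega>. \<exists>i<m. v = \<omega> @ replicate i 0" if v: "v \<in> words p" for v
  proof -
    define t where "t = trailing_zeros v"
    obtain u where u: "v = u @ replicate t 0" using trailing_zeros_decomp t_def by blast
    let ?w = "u @ replicate (m * (t div m)) 0"
    have vw: "v = ?w @ replicate (t mod m) 0"
      by (simp add: u flip: replicate_add)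
    then have "t = t mod m + trailing_zeros ?w"
      unfolding t_def by (metis trailing_zeros_append)
    then have "trailing_zeros ?w = m * (t div m)"
      by (metis add_left_cancel mod_mult_div_eq)
    moreover have "?w \<in> words p" using v vw by (metis words_append)
    ultimately have "?w \<in> \<Omega>" by (simp add: \<Omega>_def)
    then show ?thesis using vw m by (metis mod_less_divisor)
  qed
  have unique: "\<omega> = \<omega>'" if "\<omega> \<in> \<Omega>" "\<omega>' \<in> \<Omega>" "i < m" "j < m"
      "\<omega> @ replicate i 0 = \<omega>' @ replicate j 0" for \<omega> \<omega>' i j
  proof -
    have "i + trailing_zeros \<omega> = j + trailing_zeros \<omega>'"
      using that(5) by (metis trailing_zeros_append)
    moreover have "(i + trailing_zeros \<omega>) mod m = i" "(j + trailing_zeros \<omega>') mod m = j"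
      using that(1-4) by (auto simp: \<Omega>_def)
    ultimately have "i = j" by simp
    then show ?thesis using that(5) by simp
  qed
  have "tiling p (comb p m) \<Omega>"
    unfolding tiling_def
  proof (intro conjI ballI impI)
    show "subtree p (comb p m)" using p by (rule comb_subtree)
    have "pverts (comb p m) = insert [] ((\<lambda>(i, c). replicate i 0 @ [c]) ` ({..<m} \<times> {..<p}))"
      by (auto simp: comb_def)
    then show "finite (pverts (comb p m))" by simp
    show "parcs (comb p m) \<noteq> {}" using p m by (auto simp: comb_def)
    show "\<Omega> \<subseteq> words p" by (auto simp: \<Omega>_def)
  next
    fix v assume "v \<in> pverts (full_tree p)"
    then have "v \<in> words p" by (simp add: full_tree_def)
    then obtain \<omega> i where "\<omega> \<in> \<Omega>" "i < m" "v = \<omega> @ replicate i 0"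
      using split by blast
    then show "\<exists>\<omega>\<in>\<Omega>. v \<in> pverts (translate \<omega> (comb p m))"
      using replicate_comb[OF p, of i m] by (auto simp: translate_def)
  next
    fix e assume "e \<in> parcs (full_tree p)"
    then obtain v c where e: "e = (v, v @ [c])" "v \<in> words p" "c < p"
      by (auto simp: full_tree_def)
    then obtain \<omega> i where *: "\<omega> \<in> \<Omega>" "i < m" "v = \<omega> @ replicate i 0"
      using split by blast
    have "(replicate i 0, replicate i 0 @ [c]) \<in> parcs (comb p m)"
      using * e by (auto simp: comb_def)
    then have "e \<in> parcs (translate \<omega> (comb p m))"
      using e * by (force simp: translate_def)
    then show "\<exists>\<omega>\<in>\<Omega>. e \<in> parcs (translate \<omega> (comb p m))" using * by blast
  next
    fix \<omega> \<omega>' assume *: "\<omega> \<in> \<Omega>" "\<omega>' \<in> \<Omega>" "\<omega> \<noteq> \<omega>'"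
    show "parcs (translate \<omega> (comb p m)) \<inter> parcs (translate \<omega>' (comb p m)) = {}"
    proof (rule ccontr)
      assume "\<not> ?thesis"
      then obtain i j where "i < m" "j < m" "\<omega> @ replicate i 0 = \<omega>' @ replicate j 0"
        by (auto simp: translate_def comb_def)
      then show False using unique * by blast
    qed
  qed
  then show ?thesis by (auto simp: tile_def)
qed

text \<open>
  The leaves are the words \<open>0\<^bsup>i\<^esup>c\<close> with \<open>i < m\<close> and \<open>c \<noteq> 0\<close>, together with the tip \<open>0\<^bsup>m\<^esup>\<close> of the spine.
\<close>

lemma card_leaves_comb:
  assumes p: "p > 1" and m: "m > 0"
  shows "card (leaves (comb p m)) = m * (p - 1) + 1"
proof -
  let ?g = "\<lambda>(i, c). replicate i 0 @ [c] :: word"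
  let ?A = "{..<m} \<times> {1..<p}"
  have child: "replicate i 0 @ [c] @ [d] \<in> pverts (comb p m) \<longleftrightarrow> c = 0 \<and> Suc i < m \<and> d < p" for i c d
  proof
    assume "replicate i 0 @ [c] @ [d] \<in> pverts (comb p m)"
    then obtain j where j: "replicate i 0 @ [c] = replicate j 0" "j < m" "d < p"
      by (auto simp: comb_def)
    then have "c \<in> set (replicate j 0)" "length (replicate i 0 @ [c]) = j"
      by (metis in_set_conv_decomp, metis length_replicate)
    then show "c = 0 \<and> Suc i < m \<and> d < p" using j by auto
  next
    assume "c = 0 \<and> Suc i < m \<and> d < p"
    then show "replicate i 0 @ [c] @ [d] \<in> pverts (comb p m)"
      by (auto simp: comb_def intro!: exI[of _ "Suc i"] simp: replicate_append_same)
  qed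
  have "leaves (comb p m) = insert (replicate m 0) (?g ` ?A)" (is "_ = ?R")
  proof (intro equalityI subsetI)
    fix v assume v: "v \<in> leaves (comb p m)"
    have "[] @ [0] \<in> pverts (comb p m)" using p m by (auto simp: comb_def)
    then have "v \<noteq> []" using v by (auto simp: leaves_def)
    then obtain i c where ic: "v = replicate i 0 @ [c]" "i < m" "c < p"
      using v by (auto simp: leaves_def comb_def)
    have "\<not> (c = 0 \<and> Suc i < m)"
      using v child[of i c 0] p ic by (auto simp: leaves_def)
    then have "c \<noteq> 0 \<or> Suc i = m" using ic by auto
    then show "v \<in> ?R"
      using ic by (cases "c = 0") (force simp: replicate_append_same)+
  next
    fix v assume "v \<in> ?R"
    moreover have "replicate m 0 = replicate (m - 1) 0 @ [0 :: nat]"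
      using m by (cases m) (simp_all add: replicate_append_same)
    ultimately obtain i c where "v = replicate i 0 @ [c]" "i < m" "c < p" "c \<noteq> 0 \<or> Suc i = m"
      using m p by (cases "v = replicate m 0") auto
    then show "v \<in> leaves (comb p m)"
      using child[of i c] by (auto simp: leaves_def comb_def)
  qed
  moreover have "replicate m 0 \<notin> ?g ` ?A"
  proof
    assume "replicate m 0 \<in> ?g ` ?A"
    then have "\<exists>i c. replicate m 0 = replicate i 0 @ [c :: nat] \<and> 1 \<le> c" by auto
    then obtain i c where "replicate m 0 = replicate i 0 @ [c :: nat]" "1 \<le> c" by blast
    then have "c \<in> set (replicate m 0)" by simp
    then show False using \<open>1 \<le> c\<close> by simp
  qed
  moreover have "inj_on ?g ?A" by (auto simp: inj_on_def)
  ultimately show ?thesis using p by (simp add: card_image)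
qed

section \<open>Letterwise substitution between two codes\<close>

lemma topspace_padic: "p \<ge> 2 \<Longrightarrow> topspace (padic_topology p) = padic_ints p"
  unfolding padic_topology_def
  by (rule Metric_space.topspace_mtopology[OF Metric_space_padic])

lemma leaf_words_eq: "leaf_words S n = concat ` code_lists (leaves S) n"
  by (auto simp: leaf_words_def code_lists_def)

lemma map_code_lists: "f ` L \<subseteq> M \<Longrightarrow> ls \<in> code_lists L n \<Longrightarrow> map f ls \<in> code_lists M n"
  by (auto simp: code_lists_def)

lemma bij_betw_map_code_lists:
  assumes "bij_betw f L M"
  shows "bij_betw (map f) (code_lists L n) (code_lists M n)"
proof (rule bij_betw_byWitness[where f' = "map (inv_into L f)"])
  show "\<forall>ls\<in>code_lists L n. map (inv_into L f) (map f ls) = ls"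
    using bij_betw_inv_into_left[OF assms] by (auto simp: code_lists_def intro!: map_idI)
  show "\<forall>ls\<in>code_lists M n. map f (map (inv_into L f) ls) = ls"
    using bij_betw_inv_into_right[OF assms] by (auto simp: code_lists_def intro!: map_idI)
  show "map f ` code_lists L n \<subseteq> code_lists M n"
    using map_code_lists[of f L M] bij_betw_imp_surj_on[OF assms] by auto
  show "map (inv_into L f) ` code_lists M n \<subseteq> code_lists L n"
    using map_code_lists[of "inv_into L f" M L] bij_betw_imp_surj_on[OF bij_betw_inv_into[OF assms]] by auto
qed

text \<open>
  Substituting codewords is continuous for any map \<open>f\<close> between codes; the homeomorphism comes from
  applying this to a bijection and to its inverse.
\<close>

locale code_pair = P: complete_code p L N + Q: complete_code q M K
  for p L N q M K +
  fixes f :: "word \<Rightarrow> word"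
  assumes f_into: "f ` L \<subseteq> M"
begin

text \<open>
  This determines \<open>\<phi>\<close> on \<open>\<int>\<^sub>p\<close>, since a point is determined by its parsing.
\<close>

definition conjugates :: "((nat \<Rightarrow> int) \<Rightarrow> (nat \<Rightarrow> int)) \<Rightarrow> bool" where
  "conjugates \<phi> \<longleftrightarrow>
    (\<forall>x\<in>padic_ints p. \<phi> x \<in> padic_ints q \<and> (\<forall>n. Q.blocks n (\<phi> x) = map f (P.blocks n x)))"

lemma conjugates_exists: "\<exists>\<phi>. conjugates \<phi>"
  unfolding conjugates_def
proof (rule bchoice, rule ballI)
  fix x assume x: "x \<in> padic_ints p"
  have "map f (P.blocks n x) \<in> code_lists M n" for n
    using map_code_lists[OF f_into P.blocks(1)[OF x]] .
  moreover have "take n (map f (P.blocks (Suc n) x)) = map f (P.blocks n x)" for n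
    using P.take_blocks[OF x, of n "Suc n"] by (simp add: take_map)
  ultimately show "\<exists>y. y \<in> padic_ints q \<and> (\<forall>n. Q.blocks n y = map f (P.blocks n x))"
    using Q.realize_blocks[of "\<lambda>n. map f (P.blocks n x)"] by blast
qed

lemma conjugates_continuous:
  assumes \<phi>: "conjugates \<phi>"
  shows "continuous_map (padic_topology p) (padic_topology q) \<phi>"
  unfolding padic_topology_def
    Metric_space.metric_continuous_map[OF Metric_space_padic[OF P.p2] Metric_space_padic[OF Q.p2]]
proof (intro conjI ballI allI impI)
  show "\<phi> ` padic_ints p \<subseteq> padic_ints q" using \<phi> by (auto simp: conjugates_def)
  fix x and \<epsilon> :: real assume x: "x \<in> padic_ints p" and "\<epsilon> > 0"
  obtain n where n: "(1 / real q) ^ n < \<epsilon>"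
    using real_arch_pow_inv[OF \<open>\<epsilon> > 0\<close>, of "1 / real q"] Q.p2 by auto
  define \<delta> where "\<delta> = real p powi (- int (n * N))"
  have "padic_dist q (\<phi> x) (\<phi> y) < \<epsilon>" if y: "y \<in> padic_ints p" and "padic_dist p x y < \<delta>" for y
  proof -
    have "x (n * N) = y (n * N)"
      using padic_dist_le_iff[OF P.p2 x y, of "n * N"] that(2) by (simp add: \<delta>_def)
    then have "Q.blocks n (\<phi> x) = Q.blocks n (\<phi> y)"
      using P.blocks_cong[OF x y, of n] \<phi> x y by (simp add: conjugates_def)
    then have "\<phi> x n = \<phi> y n"
      using Q.blocks_separate[of "\<phi> x" "\<phi> y" n] \<phi> x y by (simp add: conjugates_def)
    then have "padic_dist q (\<phi> x) (\<phi> y) \<le> real q powi (- int n)"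
      using padic_dist_le_iff[OF Q.p2, of "\<phi> x" "\<phi> y" n] \<phi> x y by (simp add: conjugates_def)
    also have "\<dots> = (1 / real q) ^ n"
      by (simp add: power_int_minus power_one_over inverse_eq_divide)
    also have "\<dots> < \<epsilon>" by (rule n)
    finally show ?thesis .
  qed
  moreover have "\<delta> > 0" using P.p2 by (simp add: \<delta>_def)
  ultimately show "\<exists>\<delta>>0. \<forall>y. y \<in> padic_ints p \<and> padic_dist p x y < \<delta> \<longrightarrow> padic_dist q (\<phi> x) (\<phi> y) < \<epsilon>"
    by blast
qed

text \<open>
  A point of the intersection agrees with \<open>\<phi> x\<close> in all blocks, hence in all digits.
\<close>

lemma conjugates_Inter:
  assumes \<phi>: "conjugates \<phi>" and x: "x \<in> padic_ints p"
  shows "(\<Inter>n\<in>{1..}. word_ball q (concat (map f (P.blocks n x)))) = {\<phi> x}"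
proof (intro equalityI subsetI)
  have \<phi>x: "\<phi> x \<in> padic_ints q" "\<And>n. Q.blocks n (\<phi> x) = map f (P.blocks n x)"
    using \<phi> x by (auto simp: conjugates_def)
  show "y \<in> (\<Inter>n\<in>{1..}. word_ball q (concat (map f (P.blocks n x))))" if "y \<in> {\<phi> x}" for y
    using that Q.blocks(2)[OF \<phi>x(1)] by (simp add: \<phi>x(2))
  fix y assume "y \<in> (\<Inter>n\<in>{1..}. word_ball q (concat (map f (P.blocks n x))))"
  then have y: "y \<in> word_ball q (concat (map f (P.blocks n x)))" if "n \<ge> 1" for n
    using that by blast
  then have yq: "y \<in> padic_ints q" using y[of 1] by (simp add: word_ball_def)
  have "y n = \<phi> x n" for n
  proof (cases "n = 0")
    case True
    have "z 0 = 0" if "z \<in> padic_ints q" for z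
      using that by (auto simp: padic_ints_def dest!: spec[of _ 0])
    from this[OF yq] this[OF \<phi>x(1)] show ?thesis using True by simp
  next
    case False
    have "Q.blocks n y = Q.blocks n (\<phi> x)"
      using Q.blocksI[OF map_code_lists[OF f_into P.blocks(1)[OF x]] y] False by (simp add: \<phi>x(2))
    then show ?thesis by (rule Q.blocks_separate[OF yq \<phi>x(1)])
  qed
  then show "y \<in> {\<phi> x}" by auto
qed

end

lemma conjugates_homeomorphic:
  assumes "code_pair p L N q M K f" and f: "bij_betw f L M"
    and \<phi>: "code_pair.conjugates p L q M f \<phi>"
  shows "homeomorphic_map (padic_topology p) (padic_topology q) \<phi>"
proof -
  interpret A: code_pair p L N q M K f by fact
  interpret B: code_pair q M K p L N "inv_into L f"
    using bij_betw_imp_surj_on[OF bij_betw_inv_into[OF f]] by unfold_locales simp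
  obtain \<psi> where \<psi>: "B.conjugates \<psi>" using B.conjugates_exists by blast
  have f_inv: "map (inv_into L f) (map f ls) = ls" if "ls \<in> code_lists L n" for ls n
    using that bij_betw_inv_into_left[OF f] by (auto simp: code_lists_def intro!: map_idI)
  have inv_f: "map f (map (inv_into L f) ls) = ls" if "ls \<in> code_lists M n" for ls n
    using that bij_betw_inv_into_right[OF f] by (auto simp: code_lists_def intro!: map_idI)
  have "homeomorphic_maps (padic_topology p) (padic_topology q) \<phi> \<psi>"
    unfolding homeomorphic_maps_def
  proof (intro conjI ballI)
    show "continuous_map (padic_topology p) (padic_topology q) \<phi>"
      by (rule A.conjugates_continuous[OF \<phi>])
    show "continuous_map (padic_topology q) (padic_topology p) \<psi>"
      by (rule B.conjugates_continuous[OF \<psi>])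
    fix x assume "x \<in> topspace (padic_topology p)"
    then have x: "x \<in> padic_ints p" by (simp add: topspace_padic A.P.p2 A.Q.p2)
    then have *: "\<psi> (\<phi> x) \<in> padic_ints p" "\<And>n. A.P.blocks n (\<psi> (\<phi> x)) = A.P.blocks n x"
      using \<phi> \<psi> f_inv[OF A.P.blocks(1)[OF x]] by (auto simp: A.conjugates_def B.conjugates_def)
    show "\<psi> (\<phi> x) = x" using A.P.blocks_separate[OF *(1) x *(2)] by (rule ext)
  next
    fix y assume "y \<in> topspace (padic_topology q)"
    then have y: "y \<in> padic_ints q" by (simp add: topspace_padic A.P.p2 A.Q.p2)
    then have *: "\<phi> (\<psi> y) \<in> padic_ints q" "\<And>n. A.Q.blocks n (\<phi> (\<psi> y)) = A.Q.blocks n y"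
      using \<phi> \<psi> inv_f[OF A.Q.blocks(1)[OF y]] by (auto simp: A.conjugates_def B.conjugates_def)
    show "\<phi> (\<psi> y) = y" using A.Q.blocks_separate[OF *(1) y *(2)] by (rule ext)
  qed
  then show ?thesis using homeomorphic_map_maps by blast
qed

section \<open>The homeomorphism between the p-adic and the q-adic integers\<close>

text \<open>
  The words in \<open>L\<^sub>n(S)\<close> correspond to lists of \<open>n\<close> leaves, and their balls to the words, so that
  \<open>F n\<close> and \<open>G n\<close> can be defined by transporting the map \<open>map f\<close> on lists through these
  bijections.
\<close>

lemma tiles_conjugate:
  assumes p: "p \<ge> 2" and q: "q \<ge> 2"
    and S: "tile p S" and S': "tile q S'" and bij_f: "bij_betw f (leaves S) (leaves S')"
  shows
    "(\<forall>n\<ge>1. partition_on (padic_ints p) (word_ball p ` leaf_words S n) \<and>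
                partition_on (padic_ints q) (word_ball q ` leaf_words S' n)) \<and>
        (\<exists>(F :: nat \<Rightarrow> word \<Rightarrow> word)
          (G :: nat \<Rightarrow> (nat \<Rightarrow> int) set \<Rightarrow> (nat \<Rightarrow> int) set)
          (\<phi> :: (nat \<Rightarrow> int) \<Rightarrow> (nat \<Rightarrow> int)).
           (\<forall>n\<ge>1.
              (\<forall>ls. length ls = n \<and> set ls \<subseteq> leaves S \<longrightarrow> F n (concat ls) = concat (map f ls)) \<and>
              bij_betw (F n) (leaf_words S n) (leaf_words S' n) \<and>
              (\<forall>l \<in> leaf_words S n. G n (word_ball p l) = word_ball q (F n l)) \<and>
              bij_betw (G n) (word_ball p ` leaf_words S n) (word_ball q ` leaf_words S' n) \<and>
              (\<forall>l \<in> leaf_words S n. \<forall>k \<in> leaf_words S (n + 1).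
                 word_ball p k \<subseteq> word_ball p l \<longleftrightarrow>
                 G (n + 1) (word_ball p k) \<subseteq> G n (word_ball p l))) \<and>
           (\<forall>x \<in> padic_ints p.
              (\<forall>n\<ge>1. \<exists>!l. l \<in> leaf_words S n \<and> x \<in> word_ball p l) \<and>
              (\<Inter>n\<in>{1..}. G n (word_ball p (THE l. l \<in> leaf_words S n \<and> x \<in> word_ball p l))) = {\<phi> x}) \<and>
           homeomorphic_map (padic_topology p) (padic_topology q) \<phi>)"
proof -
  obtain N where "complete_code p (leaves S) N" using tile_leaves_code[OF S p] by blast
  then interpret P: complete_code p "leaves S" N .
  obtain K where "complete_code q (leaves S') K" using tile_leaves_code[OF S' q] by blast
  then interpret Q: complete_code q "leaves S'" K .
  interpret code_pair p "leaves S" N q "leaves S'" K f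
    using bij_betw_imp_surj_on[OF bij_f] by unfold_locales simp
  obtain \<phi> where \<phi>: "conjugates \<phi>" using conjugates_exists by blast
  note f_lists = map_code_lists[OF f_into]
  define F where "F n = concat \<circ> map f \<circ> inv_into (code_lists (leaves S) n) concat" for n
  define G where "G n = word_ball q \<circ> F n \<circ> inv_into (leaf_words S n) (word_ball p)" for n
  have F: "F n (concat ls) = concat (map f ls)" if "ls \<in> code_lists (leaves S) n" for n ls
    using inv_into_f_f[OF P.concat_inj that] by (simp add: F_def)
  have G: "G n (word_ball p l) = word_ball q (F n l)" if "l \<in> leaf_words S n" for n l
    using inv_into_f_f[OF P.ball_inj] that by (simp add: G_def leaf_words_eq)
  have bij_F: "bij_betw (F n) (leaf_words S n) (leaf_words S' n)" for n
    unfolding F_def leaf_words_eq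
    by (intro bij_betw_trans[OF bij_betw_inv_into] bij_betw_trans[OF bij_betw_map_code_lists[OF bij_f]]
        inj_on_imp_bij_betw P.concat_inj Q.concat_inj)
  have bij_G: "bij_betw (G n) (word_ball p ` leaf_words S n) (word_ball q ` leaf_words S' n)" for n
    unfolding G_def
    using bij_betw_trans[OF bij_betw_inv_into[OF inj_on_imp_bij_betw[OF P.ball_inj]]
        bij_betw_trans[OF bij_F[unfolded leaf_words_eq] inj_on_imp_bij_betw[OF Q.ball_inj]]]
    by (simp add: leaf_words_eq comp_assoc)
  have nested: "word_ball p k \<subseteq> word_ball p l \<longleftrightarrow> G (n + 1) (word_ball p k) \<subseteq> G n (word_ball p l)"
    if l: "l \<in> leaf_words S n" and k: "k \<in> leaf_words S (n + 1)" for n l k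
  proof -
    obtain ls where ls: "ls \<in> code_lists (leaves S) n" "l = concat ls"
      using l by (auto simp: leaf_words_eq)
    obtain ks where ks: "ks \<in> code_lists (leaves S) (n + 1)" "k = concat ks"
      using k by (auto simp: leaf_words_eq)
    have tk: "take n ks \<in> code_lists (leaves S) n"
      using ks(1) by (auto simp: code_lists_def dest: in_set_takeD)
    have "word_ball p k \<subseteq> word_ball p l \<longleftrightarrow> take n ks = ls"
      unfolding ls(2) ks(2) by (rule P.ball_subset_iff[OF ls(1) ks(1)]) simp
    also have "\<dots> \<longleftrightarrow> take n (map f ks) = map f ls"
      using inj_onD[OF bij_betw_imp_inj_on[OF bij_betw_map_code_lists[OF bij_f]] _ tk ls(1)]
      by (auto simp: take_map)
    also have "\<dots> \<longleftrightarrow> word_ball q (concat (map f ks)) \<subseteq> word_ball q (concat (map f ls))"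
      by (rule Q.ball_subset_iff[OF f_lists[OF ls(1)] f_lists[OF ks(1)], symmetric]) simp
    finally show ?thesis using G[OF l] G[OF k] F[OF ls(1)] F[OF ks(1)] ls(2) ks(2) by simp
  qed
  have parse: "l \<in> leaf_words S n \<and> x \<in> word_ball p l \<longleftrightarrow> l = concat (P.blocks n x)"
    if x: "x \<in> padic_ints p" for x n l
    using P.blocks(1,2)[OF x, of n] P.in_ball_blocks_iff[OF x] by (auto simp: leaf_words_eq)
  have Inter: "(\<Inter>n\<in>{1..}. G n (word_ball p (THE l. l \<in> leaf_words S n \<and> x \<in> word_ball p l))) = {\<phi> x}"
    if x: "x \<in> padic_ints p" for x
  proof -
    have "G n (word_ball p (concat (P.blocks n x))) = word_ball q (concat (map f (P.blocks n x)))" for n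
      using P.blocks(1)[OF x, of n] G F by (simp add: leaf_words_eq)
    then show ?thesis using conjugates_Inter[OF \<phi> x] by (simp add: parse[OF x])
  qed
  show ?thesis
  proof (intro conjI exI[of _ F] exI[of _ G] exI[of _ \<phi>] allI impI ballI)
    show "partition_on (padic_ints p) (word_ball p ` leaf_words S n)"
      "partition_on (padic_ints q) (word_ball q ` leaf_words S' n)" for n
      using P.ball_partition Q.ball_partition by (simp_all add: leaf_words_eq)
    show "F n (concat ls) = concat (map f ls)" if "length ls = n \<and> set ls \<subseteq> leaves S" for n ls
      using F[of ls n] that by (simp add: code_lists_def)
    show "\<exists>!l. l \<in> leaf_words S n \<and> x \<in> word_ball p l" if "x \<in> padic_ints p" for n x
      using parse[OF that] by simp
    show "homeomorphic_map (padic_topology p) (padic_topology q) \<phi>"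
      by (rule conjugates_homeomorphic[OF code_pair_axioms bij_f \<phi>])
  qed (use bij_F bij_G G nested Inter in auto)
qed

theorem mainTheorem3:
  fixes p q :: nat
  assumes "prime p" and "prime q"
  shows
    "(\<exists>S S'. tile p S \<and> tile q S' \<and> card (leaves S) = card (leaves S')) \<and>
     (\<forall>S S' f.
        tile p S \<longrightarrow> tile q S' \<longrightarrow> card (leaves S) = card (leaves S') \<longrightarrow>
        bij_betw f (leaves S) (leaves S') \<longrightarrow>
        (\<forall>n\<ge>1. partition_on (padic_ints p) (word_ball p ` leaf_words S n) \<and>
                partition_on (padic_ints q) (word_ball q ` leaf_words S' n)) \<and>
        (\<exists>(F :: nat \<Rightarrow> word \<Rightarrow> word)
          (G :: nat \<Rightarrow> (nat \<Rightarrow> int) set \<Rightarrow> (nat \<Rightarrow> int) set)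
          (\<phi> :: (nat \<Rightarrow> int) \<Rightarrow> (nat \<Rightarrow> int)).
           (\<forall>n\<ge>1.
              (\<forall>ls. length ls = n \<and> set ls \<subseteq> leaves S \<longrightarrow> F n (concat ls) = concat (map f ls)) \<and>
              bij_betw (F n) (leaf_words S n) (leaf_words S' n) \<and>
              (\<forall>l \<in> leaf_words S n. G n (word_ball p l) = word_ball q (F n l)) \<and>
              bij_betw (G n) (word_ball p ` leaf_words S n) (word_ball q ` leaf_words S' n) \<and>
              (\<forall>l \<in> leaf_words S n. \<forall>k \<in> leaf_words S (n + 1).
                 word_ball p k \<subseteq> word_ball p l \<longleftrightarrow>
                 G (n + 1) (word_ball p k) \<subseteq> G n (word_ball p l))) \<and>
           (\<forall>x \<in> padic_ints p.
              (\<forall>n\<ge>1. \<exists>!l. l \<in> leaf_words S n \<and> x \<in> word_ball p l) \<and>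
              (\<Inter>n\<in>{1..}. G n (word_ball p (THE l. l \<in> leaf_words S n \<and> x \<in> word_ball p l))) = {\<phi> x}) \<and>
           homeomorphic_map (padic_topology p) (padic_topology q) \<phi>))"
proof -
  have p: "p \<ge> 2" and q: "q \<ge> 2" using assms prime_ge_2_nat by blast+
  show ?thesis
  proof (rule conjI, goal_cases)
    case 1
    have "tile p (comb p (q - 1))" "tile q (comb q (p - 1))"
      using p q by (simp_all add: comb_tile)
    moreover have "card (leaves (comb p (q - 1))) = card (leaves (comb q (p - 1)))"
      using p q by (simp add: card_leaves_comb)
    ultimately show ?case by blast
  next
    case 2
    show ?case by (intro allI impI) (rule tiles_conjugate[OF p q])
  qed
qed

end
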